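(* Let $A\in\mathcal{M}_n(\mathbb{C})$ and $B=(b_{ij})_{i,j=1,\ldots,m}\in\mathcal{M}_m(\mathbb{C})$. Regard $A\wr B$ as an $m^n\times m^n$ matrix whose entries are blocks of order $n$. (1) Let $i,j\in\{1,\ldots,m\}$ with $i\neq j$, and let $k\in\{1,\ldots,n\}$. Then the number of blocks of type $b_{ij}C_k$ appearing in $A\wr B$ is $m^{n-1}$. More precisely: - for $k=2,\ldots,n-1$, the blocks of type $b_{ij}C_k$ appear at the positions $$((i-1)m^{n-k}+s+tm^{n-k+1},\ (j-1)m^{n-k}+s+tm^{n-k+1}),\quad s=1,\ldots,m^{n-k},\ t=0,\ldots,m^{k-1}-1;$$ - the blocks of type $b_{ij}C_1$ appear at the positions $$((i-1)m^{n-1}+s,\ (j-1)m^{n-1}+s),\quad s=1,\ldots,m^{n-1};$$ - the blocks of type $b_{ij}C_n$ appear at the positions $$(i+tm,\ j+tm),\quad t=0,\ldots,m^{n-1}-1.$$ (2) Order the set of symbols $\{b_{11},\ldots,b_{mm}\}$ by $b_{ii}<b_{jj}$ if $i<j$, and let $\Omega=\{(b_1,\ldots,b_n): b_i\in\{b_{11},\ldots,b_{mm}\}\}$ be endowed with the lexicographic order: $(b_1,\ldots,b_n)<(b_1',\ldots,b_n')$ if $i=\min\{h: b_h\neq b_h'\}$ is such that $b_i<b_i'$. Then, for each $p\in\{1,\ldots,m^n\}$, the $p$-th diagonal entry of $A\wr B$ (as an $m^n\times m^n$ matrix of blocks of order $n$) is $$A+\sum_{h=1}^n b_{f_h+1,f_h+1}C_h,$$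 where $(f_1,\ldots,f_n)$ is such that $p=1+\sum_{h=1}^n f_hm^{n-h}$, with $f_h\in\{0,\ldots,m-1\}$. Moreover, $(b_{f_1+1,f_1+1},\ldots,b_{f_n+1,f_n+1})$ is the $p$-th $n$-tuple of $\Omega$ with respect to the lexicographic order. In particular, there is a bijection between the elements of $\Omega$ and the $m^n$ diagonal blocks of $A\wr B$.
   Context: $n,m$ are positive integers. Wreath product of matrices: for $A\in\mathcal{M}_n(\mathbb{C})$ and $B\in\mathcal{M}_m(\mathbb{C})$, $$A\wr B = I_m^{\otimes n}\otimes A+\sum_{i=1}^n I_m^{\otimes (i-1)}\otimes B\otimes I_m^{\otimes (n-i)}\otimes C_i,$$ a square matrix of order $nm^n$. Here $\otimes$ is the Kronecker product ($M\otimes N$ is the block matrix with blocks $m_{ij}N$), $I_m^{\otimes r}$ is the $r$-fold Kronecker power, with $I_m^{\otimes 0}=1$, and $C_i\in\mathcal{M}_n(\mathbb{C})$ has entry $1$ in position $(i,i)$ and $0$ elsewhere. The entries $b_{ij}$ of $B$ are treated as distinct formal symbols when counting blocks "of type $b_{ij}C_k$", when ordering $\{b_{11},\ldots,b_{mm}\}$ and when forming $\Omega$ (so $|\Omega|=m^n$); accidental numerical coincidences among the $b_{ij}$ are ignored, and "diagonal blocks" are indexed by their positions. *)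

theory Defs
  imports Complex_Main "HOL-Library.Poly_Mapping" "HOL-Library.FuncSet" "Jordan_Normal_Form.Matrix"
begin

definition kron :: "'a::comm_ring_1 mat \<Rightarrow> 'a mat \<Rightarrow> 'a mat"  (infixl \<open>\<otimes>\<^sub>K\<close> 72) where
  "M \<otimes>\<^sub>K N = mat (dim_row M * dim_row N) (dim_col M * dim_col N)
     (\<lambda>(r, c). M $$ (r div dim_row N, c div dim_col N) * N $$ (r mod dim_row N, c mod dim_col N))"

primrec kron_pow :: "'a::comm_ring_1 mat \<Rightarrow> nat \<Rightarrow> 'a mat" where
  "kron_pow M 0 = 1\<^sub>m 1"
| "kron_pow M (Suc r) = M \<otimes>\<^sub>K kron_pow M r"

text \<open>The type of matrices of all sizes has no zero element, so \<^const>\<open>sum\<close> does not apply to it;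
  \<open>mat_sum d F I\<close> is the sum of the \<open>d\<times>d\<close> matrices \<open>F i\<close>, \<open>i \<in> I\<close>.\<close>

definition mat_sum :: "nat \<Rightarrow> ('i \<Rightarrow> 'a::comm_ring_1 mat) \<Rightarrow> 'i set \<Rightarrow> 'a mat" where
  "mat_sum d F I = mat d d (\<lambda>(r, c). \<Sum>i\<in>I. F i $$ (r, c))"

text \<open>The index \<open>i\<close> of \<open>C_mat n i\<close>, the block positions \<open>p\<close>, \<open>q\<close> of \<open>blk\<close> and the indices of the symbols
  \<open>Entry i j\<close> below count from 1; only \<open>$$\<close> and list indexing count from 0.\<close>

definition C_mat :: "nat \<Rightarrow> nat \<Rightarrow> 'a::comm_ring_1 mat" where
  "C_mat n i = mat n n (\<lambda>(r, c). if r = i - 1 \<and> c = i - 1 then 1 else 0)"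

text \<open>The wreath product is defined over any commutative ring because it is used both over the
  complex numbers and over the ring of polynomials in the formal entries of \<open>B\<close>.\<close>

definition wreath :: "'a::comm_ring_1 mat \<Rightarrow> 'a mat \<Rightarrow> 'a mat"  (infixl \<open>\<wr>\<close> 72) where
  "A \<wr> B = (let n = dim_row A; m = dim_row B in
     kron_pow (1\<^sub>m m) n \<otimes>\<^sub>K A +
     mat_sum (n * m ^ n)
       (\<lambda>i. kron_pow (1\<^sub>m m) (i - 1) \<otimes>\<^sub>K B \<otimes>\<^sub>K kron_pow (1\<^sub>m m) (n - i) \<otimes>\<^sub>K C_mat n i) {1..n})"

definition blk :: "nat \<Rightarrow> 'a mat \<Rightarrow> nat \<Rightarrow> nat \<Rightarrow> 'a mat" where
  "blk n M p q = mat n n (\<lambda>(r, c). M $$ ((p - 1) * n + r, (q - 1) * n + c))"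

text \<open>\<open>Entry i j\<close> is the symbol \<open>b\<^sub>i\<^sub>j\<close>. Distinct symbols are distinct indeterminates of the
  polynomial ring \<open>sympoly\<close>, whose monomials are the finitely supported exponent functions, and
  \<open>sym_mat m\<close> is the matrix \<open>(b\<^sub>i\<^sub>j)\<close> of indeterminates.\<close>

datatype entry = Entry nat nat

type_synonym sympoly = "(entry \<Rightarrow>\<^sub>0 nat) \<Rightarrow>\<^sub>0 complex"

definition sconst :: "complex \<Rightarrow> sympoly" where
  "sconst c = Poly_Mapping.single 0 c"

definition svar :: "entry \<Rightarrow> sympoly" where
  "svar x = Poly_Mapping.single (Poly_Mapping.single x 1) 1"

definition sym_mat :: "nat \<Rightarrow> sympoly mat" where
  "sym_mat m = mat m m (\<lambda>(r, c). svar (Entry (r + 1) (c + 1)))"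

fun entry_val :: "complex mat \<Rightarrow> entry \<Rightarrow> complex" where
  "entry_val B (Entry i j) = B $$ (i - 1, j - 1)"

text \<open>The positions at which a block of type \<open>b\<^sub>i\<^sub>j C\<^sub>k\<close> appears, for \<open>A\<close> of order \<open>n\<close> and a matrix of
  symbols of order \<open>m\<close>. Using symbols rules out coincidences such as \<open>b\<^sub>1\<^sub>2 = b\<^sub>2\<^sub>1\<close> or \<open>b\<^sub>1\<^sub>2 = 0\<close>.\<close>

definition type_positions :: "nat \<Rightarrow> nat \<Rightarrow> complex mat \<Rightarrow> nat \<Rightarrow> nat \<Rightarrow> nat \<Rightarrow> (nat \<times> nat) set" where
  "type_positions n m A i j k =
     {(p, q). p \<in> {1..m ^ n} \<and> q \<in> {1..m ^ n} \<and>
        blk n (map_mat sconst A \<wr> sym_mat m) p q = svar (Entry i j) \<cdot>\<^sub>m C_mat n k}"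

definition diag_symbols :: "nat \<Rightarrow> entry set" where
  "diag_symbols m = {Entry i i | i. i \<in> {1..m}}"

definition diag_less :: "nat \<Rightarrow> (entry \<times> entry) set" where
  "diag_less m = {(Entry i i, Entry j j) | i j. i \<in> {1..m} \<and> j \<in> {1..m} \<and> i < j}"

definition Omega :: "nat \<Rightarrow> nat \<Rightarrow> entry list set" where
  "Omega n m = {bs. length bs = n \<and> set bs \<subseteq> diag_symbols m}"

definition Omega_less :: "nat \<Rightarrow> nat \<Rightarrow> (entry list \<times> entry list) set" where
  "Omega_less n m = {(bs, cs). bs \<in> Omega n m \<and> cs \<in> Omega n m \<and> bs \<noteq> cs \<and>
     (let i = (LEAST h. h < n \<and> bs ! h \<noteq> cs ! h) in (bs ! i, cs ! i) \<in> diag_less m)}"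

text \<open>\<open>x\<close> is the \<open>p\<close>-th element (counting from 1) of the finite set \<open>S\<close> listed in strictly increasing
  order with respect to \<open>r\<close>.\<close>

definition is_pth :: "('a \<times> 'a) set \<Rightarrow> 'a set \<Rightarrow> nat \<Rightarrow> 'a \<Rightarrow> bool" where
  "is_pth r S p x \<longleftrightarrow> (\<exists>xs. sorted_wrt (\<lambda>y z. (y, z) \<in> r) xs \<and> distinct xs \<and> set xs = S \<and>
     p \<in> {1..length xs} \<and> xs ! (p - 1) = x)"

end

theory Submission
  imports Defs
begin

text \<open>Counting from 0, write block positions in base \<open>m\<close> with \<open>n\<close> digits, the first one being the
  most significant. The \<open>h\<close>-th summand of the wreath product is nonzero only in the entry \<open>(h, h)\<close> of a
  block, and there only if the row and column positions of the block agree in all digits except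
  possibly the \<open>h\<close>-th one; it then equals the entry of \<open>B\<close> indexed by the two \<open>h\<close>-th digits.
  Hence an off-diagonal block is nonzero only if the two positions differ in exactly one digit,
  and a diagonal block collects one diagonal entry of \<open>B\<close> per digit. Finally, the usual order of
  numbers below \<open>m ^ n\<close> is the lexicographic order of their digit sequences.\<close>

definition digit :: "nat \<Rightarrow> nat \<Rightarrow> nat \<Rightarrow> nat \<Rightarrow> nat" where
  "digit m n h p = p div m ^ (n - h) mod m"

text \<open>The quotient by \<open>m ^ (n - h + 1)\<close> carries the digits before the
  \<open>h\<close>-th one, the remainder modulo \<open>m ^ (n - h)\<close> those after it; the
  \<open>h\<close>-th digit is left free.\<close>

definition agree_off :: "nat \<Rightarrow> nat \<Rightarrow> nat \<Rightarrow> nat \<Rightarrow> nat \<Rightarrow> bool" where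
  "agree_off m n h p q \<longleftrightarrow>
     p div m ^ (n - h + 1) = q div m ^ (n - h + 1) \<and> p mod m ^ (n - h) = q mod m ^ (n - h)"

text \<open>The tuple belonging to the diagonal block at zero-based position \<open>p\<close>.
  Adding 1 passes from digits, which start at 0, to symbol indices, which start at 1.\<close>

definition diag_tuple :: "nat \<Rightarrow> nat \<Rightarrow> nat \<Rightarrow> entry list" where
  "diag_tuple m n p = map (\<lambda>h. Entry (digit m n h p + 1) (digit m n h p + 1)) [1..<n + 1]"

section \<open>Digits\<close>

lemma digit_less: "m \<ge> 1 \<Longrightarrow> digit m n h p < m"
  by (simp add: digit_def)

text \<open>The quotient is the number formed by the first \<open>k\<close> digits, so the induction
  appends one digit at a time. Taking \<open>k = n\<close> gives uniqueness of expansions; smaller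
  \<open>k\<close> serves the lexicographic comparison.\<close>

lemma div_eq_if_digits_eq:
  assumes "k \<le> n" "p < m ^ n" "q < m ^ n" "\<And>h. h \<in> {1..k} \<Longrightarrow> digit m n h p = digit m n h q"
  shows "p div m ^ (n - k) = q div m ^ (n - k)"
  using assms(1,4)
proof (induction k)
  case 0
  \<comment> \<open>Both numbers lie below \<open>m ^ n\<close>, so both quotients are 0.\<close>
  then show ?case using assms by simp
next
  case (Suc k)
  have e: "m ^ (n - k) = m ^ (n - Suc k) * m"
    using Suc.prems(1) by (metis Suc_diff_Suc Suc_le_lessD power_Suc2)
  have "p div m ^ (n - Suc k) div m = q div m ^ (n - Suc k) div m"
    using Suc.IH Suc.prems by (simp add: e div_mult2_eq)
  moreover have "p div m ^ (n - Suc k) mod m = q div m ^ (n - Suc k) mod m"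
    using Suc.prems(2)[of "Suc k"] by (simp add: digit_def)
  ultimately show ?case by (metis mult_div_mod_eq)
qed

lemma digits_inject:
  assumes "p < m ^ n" "q < m ^ n" "\<And>h. h \<in> {1..n} \<Longrightarrow> digit m n h p = digit m n h q"
  shows "p = q"
  using div_eq_if_digits_eq[of n n p m q] assms by simp

text \<open>Horner's scheme: a new least significant digit turns the old sum \<open>?S\<close> into
  \<open>?S * m + f (Suc n)\<close>, which keeps the earlier digits and stays below
  \<open>m ^ Suc n\<close> because \<open>Suc ?S\<close> is at most \<open>m ^ n\<close>.\<close>

lemma digits_of_sum:
  assumes "\<And>h. h \<in> {1..n} \<Longrightarrow> f h < m"
  shows "(\<Sum>h=1..n. f h * m ^ (n - h)) < m ^ n \<and>
    (\<forall>h\<in>{1..n}. digit m n h (\<Sum>h=1..n. f h * m ^ (n - h)) = f h)"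
  using assms
proof (induction n)
  case 0
  then show ?case by simp
next
  case (Suc n)
  let ?S = "\<Sum>h=1..n. f h * m ^ (n - h)"
  have IH: "?S < m ^ n" "\<And>h. h \<in> {1..n} \<Longrightarrow> digit m n h ?S = f h"
    using Suc by auto
  have f: "f (Suc n) < m" using Suc.prems by simp
  have "(\<Sum>h=1..n. f h * m ^ (Suc n - h)) = ?S * m"
    unfolding sum_distrib_right by (rule sum.cong) (simp_all add: Suc_diff_le)
  then have S: "(\<Sum>h=1..Suc n. f h * m ^ (Suc n - h)) = ?S * m + f (Suc n)" by simp
  have "?S * m + f (Suc n) < Suc ?S * m" using f by simp
  also have "\<dots> \<le> m ^ n * m" using IH(1) by (intro mult_right_mono) auto
  finally have "?S * m + f (Suc n) < m ^ Suc n" by (simp add: mult.commute)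
  moreover have "digit m (Suc n) h (?S * m + f (Suc n)) = f h" if "h \<in> {1..Suc n}" for h
  proof (cases "h = Suc n")
    case True
    then show ?thesis using f by (simp add: digit_def)
  next
    case False
    then have h: "h \<in> {1..n}" using that by auto
    then have "m ^ (Suc n - h) = m * m ^ (n - h)" by (simp add: Suc_diff_le)
    then show ?thesis using IH(2)[OF h] f by (simp add: digit_def div_mult2_eq)
  qed
  ultimately show ?case unfolding S by blast
qed

text \<open>Both sides lie below \<open>m ^ n\<close> and have the same digits, so
  \<open>digits_inject\<close> identifies them.\<close>

lemma sum_of_digits:
  assumes "m \<ge> 1" "p < m ^ n"
  shows "(\<Sum>h=1..n. digit m n h p * m ^ (n - h)) = p"
proof (rule digits_inject[OF _ assms(2)])
  note S = digits_of_sum[of n "\<lambda>h. digit m n h p" m, OF digit_less[OF assms(1)]]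
  show "(\<Sum>h=1..n. digit m n h p * m ^ (n - h)) < m ^ n" using S by blast
  show "digit m n h (\<Sum>h=1..n. digit m n h p * m ^ (n - h)) = digit m n h p" if "h \<in> {1..n}" for h
    using S that by blast
qed

text \<open>Agreement off \<open>h\<close> covers every digit after the \<open>h\<close>-th, among
  them the \<open>k\<close>-th; agreement off \<open>k\<close> covers all the others. Hence off the
  diagonal at most one \<open>C_mat n k\<close> can occur in a block.\<close>

lemma agree_off_eq_if_less:
  assumes "agree_off m n h p q" "agree_off m n k p q" "h < k" "k \<le> n"
  shows "p = q"
proof -
  have "n - k + 1 \<le> n - h" using assms by auto
  then have "m ^ (n - k + 1) dvd m ^ (n - h)" by (rule le_imp_power_dvd)
  then have "p mod m ^ (n - k + 1) = q mod m ^ (n - k + 1)"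
    using assms(1) unfolding agree_off_def by (metis mod_mod_cancel)
  then show ?thesis using assms(2) unfolding agree_off_def by (metis mult_div_mod_eq)
qed

lemma agree_off_eq:
  assumes "agree_off m n h p q" "agree_off m n k p q" "h \<noteq> k" "h \<le> n" "k \<le> n"
  shows "p = q"
  using assms agree_off_eq_if_less by (metis nat_neq_iff)

text \<open>Source of the explicit positions: the common digits after the \<open>k\<close>-th form
  \<open>s\<close>, the common digits before it form \<open>t\<close>. Here \<open>s\<close> starts
  at 0, since positions are zero-based.\<close>

lemma agree_off_iff:
  assumes "i < m" "j < m" "m \<ge> 1"
  shows "agree_off m n k p q \<and> digit m n k p = i \<and> digit m n k q = j \<longleftrightarrow>
    (\<exists>s t. s < m ^ (n - k) \<and> p = i * m ^ (n - k) + s + t * m ^ (n - k + 1) \<and>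
           q = j * m ^ (n - k) + s + t * m ^ (n - k + 1))"
proof -
  define M where "M = m ^ (n - k)"
  have M: "M > 0" "m ^ (n - k + 1) = M * m" using assms by (simp_all add: M_def)
  have split: "x = x div M mod m * M + x mod M + x div (M * m) * (M * m)" for x
  proof -
    have *: "x = d * M + r + z * (M * m)" if "x = y * M + r" "y = z * m + d" for y r z d
      using that by (simp add: algebra_simps)
    show ?thesis
      unfolding div_mult2_eq by (rule *[of "x div M" _ "x div M div m"]) simp_all
  qed
  \<comment> \<open>Uniqueness of the decomposition \<open>split\<close>, which yields the converse
    direction.\<close>
  have parts: "(i * M + s + t * (M * m)) div M mod m = i \<and> (i * M + s + t * (M * m)) mod M = s \<and>
      (i * M + s + t * (M * m)) div (M * m) = t" if "i < m" "s < M" for i s t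
  proof -
    have e: "i * M + s + t * (M * m) = s + (i + t * m) * M" by (simp add: algebra_simps)
    show ?thesis unfolding e using that M by (simp add: div_mult2_eq)
  qed
  have "p div (M * m) = q div (M * m) \<and> p mod M = q mod M \<and>
      p div M mod m = i \<and> q div M mod m = j \<longleftrightarrow>
      (\<exists>s t. s < M \<and> p = i * M + s + t * (M * m) \<and> q = j * M + s + t * (M * m))"
  proof
    assume "p div (M * m) = q div (M * m) \<and> p mod M = q mod M \<and> p div M mod m = i \<and> q div M mod m = j"
    then show "\<exists>s t. s < M \<and> p = i * M + s + t * (M * m) \<and> q = j * M + s + t * (M * m)"
      using split[of p] split[of q] M(1) by (metis mod_less_divisor)
  qed (use parts assms in auto)
  then show ?thesis
    unfolding agree_off_def digit_def M_def[symmetric] M(2) by blast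
qed

section \<open>Entries and blocks of the wreath product\<close>

lemma mult_add_less:
  fixes a b :: nat
  assumes "a < x" "b < y"
  shows "a * y + b < x * y"
proof -
  have "a * y + b < Suc a * y" using assms by simp
  also have "\<dots> \<le> x * y" using assms by (intro mult_right_mono) auto
  finally show ?thesis .
qed

lemma dim_kron [simp]:
  "dim_row (M \<otimes>\<^sub>K N) = dim_row M * dim_row N" "dim_col (M \<otimes>\<^sub>K N) = dim_col M * dim_col N"
  by (simp_all add: kron_def)

lemma index_kron:
  "r < dim_row M * dim_row N \<Longrightarrow> c < dim_col M * dim_col N \<Longrightarrow>
   (M \<otimes>\<^sub>K N) $$ (r, c) = M $$ (r div dim_row N, c div dim_col N) * N $$ (r mod dim_row N, c mod dim_col N)"
  by (simp add: kron_def)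

lemma kron_one: "(1\<^sub>m a :: 'a::comm_ring_1 mat) \<otimes>\<^sub>K 1\<^sub>m b = 1\<^sub>m (a * b)"
proof (rule eq_matI)
  fix r c assume "r < dim_row (1\<^sub>m (a * b))" "c < dim_col (1\<^sub>m (a * b))"
  then have rc: "r < a * b" "c < a * b" by auto
  then have b: "b > 0" by (cases b) auto
  then have "r div b < a" "c div b < a" using rc by (auto simp: less_mult_imp_div_less)
  moreover have "r div b = c div b \<and> r mod b = c mod b \<longleftrightarrow> r = c" by (metis mult_div_mod_eq)
  ultimately show "((1\<^sub>m a :: 'a mat) \<otimes>\<^sub>K 1\<^sub>m b) $$ (r, c) = 1\<^sub>m (a * b) $$ (r, c)"
    using rc b by (auto simp: index_kron)
qed auto

lemma kron_pow_one: "kron_pow (1\<^sub>m m) r = (1\<^sub>m (m ^ r) :: 'a::comm_ring_1 mat)"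
  by (induction r) (simp_all add: kron_one)

lemma dim_C_mat [simp]: "dim_row (C_mat n i) = n" "dim_col (C_mat n i) = n"
  by (simp_all add: C_mat_def)

text \<open>All later results are read off from this formula. In the \<open>i\<close>-th summand the
  left and right identity factors force equal digits before and after the \<open>i\<close>-th,
  \<open>Y\<close> is evaluated at the two \<open>i\<close>-th digits, and \<open>C_mat n i\<close>
  leaves only the local entry with \<open>a = c = i - 1\<close>. So the sum collapses to
  \<open>i = Suc a\<close>.\<close>

lemma index_wreath:
  fixes X Y :: "'a::comm_ring_1 mat"
  assumes X: "X \<in> carrier_mat n n" and Y: "Y \<in> carrier_mat m m" and m: "m \<ge> 1"
    and pq: "p < m ^ n" "q < m ^ n" and ac: "a < n" "c < n"
  shows "(X \<wr> Y) $$ (p * n + a, q * n + c) = (if p = q then X $$ (a, c) else 0) +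
    (if a = c \<and> agree_off m n (Suc a) p q then Y $$ (digit m n (Suc a) p, digit m n (Suc a) q) else 0)"
proof -
  have dims: "dim_row X = n" "dim_col X = n" "dim_row Y = m" "dim_col Y = m" using X Y by auto
  have lt: "p * n + a < m ^ n * n" "q * n + c < m ^ n * n" using pq ac by (auto intro: mult_add_less)
  have summand: "(kron_pow (1\<^sub>m m) (i - 1) \<otimes>\<^sub>K Y \<otimes>\<^sub>K kron_pow (1\<^sub>m m) (n - i) \<otimes>\<^sub>K C_mat n i)
      $$ (p * n + a, q * n + c) =
      (if i = Suc a then (if a = c \<and> agree_off m n (Suc a) p q
        then Y $$ (digit m n (Suc a) p, digit m n (Suc a) q) else 0) else 0)"
    if i: "i \<in> {1..n}" for i
  proof -
    define M where "M = m ^ (n - i)"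
    define L where "L = m ^ (i - 1)"
    have e: "m ^ n = L * m * M"
    proof -
      have "n = (i - 1) + 1 + (n - i)" using i by auto
      then show ?thesis unfolding L_def M_def by (metis power_add power_one_right)
    qed
    have M: "M > 0" using m by (simp add: M_def)
    have pq': "p < L * m * M" "q < L * m * M" using pq e by auto
    \<comment> \<open>Peeling off the factors from the right: \<open>p div M\<close> is an index
      into the product of the left identity with \<open>Y\<close>; dividing it by \<open>m\<close>
      leaves the index into that identity, and the remainder is the index into
      \<open>Y\<close>.\<close>
    then have "p div M < L * m" "q div M < L * m" by (auto simp: less_mult_imp_div_less)
    moreover from this have "p div M div m < L" "q div M div m < L"
      by (auto simp: less_mult_imp_div_less)
    moreover have "x div m ^ (n - i + 1) = x div M div m" for x
      by (simp add: M_def div_mult2_eq[symmetric] mult.commute)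
    moreover have "i = Suc a \<longleftrightarrow> a = i - Suc 0" using i by auto
    ultimately show ?thesis
      using lt pq' ac M i m unfolding e kron_pow_one M_def[symmetric] L_def[symmetric]
      by (auto simp: index_kron dims C_mat_def digit_def agree_off_def M_def[symmetric]
          simp del: power_Suc)
  qed
  have "(kron_pow (1\<^sub>m m) n \<otimes>\<^sub>K X) $$ (p * n + a, q * n + c) = (if p = q then X $$ (a, c) else 0)"
    using lt pq ac by (simp add: kron_pow_one index_kron dims)
  moreover have "mat_sum (n * m ^ n)
       (\<lambda>i. kron_pow (1\<^sub>m m) (i - 1) \<otimes>\<^sub>K Y \<otimes>\<^sub>K kron_pow (1\<^sub>m m) (n - i) \<otimes>\<^sub>K C_mat n i) {1..n}
       $$ (p * n + a, q * n + c) =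
     (if a = c \<and> agree_off m n (Suc a) p q then Y $$ (digit m n (Suc a) p, digit m n (Suc a) q) else 0)"
    using lt ac by (simp add: mat_sum_def summand mult.commute[of n "m ^ n"] sum.delta
        cong: sum.cong_simp del: One_nat_def)
  ultimately show ?thesis
    using lt by (simp add: wreath_def Let_def dims mat_sum_def mult.commute[of n "m ^ n"])
qed

text \<open>A position agrees with itself off every digit, so each local diagonal entry receives
  exactly one diagonal entry of \<open>Y\<close>.\<close>

lemma blk_diag:
  fixes X Y :: "'a::comm_ring_1 mat"
  assumes "X \<in> carrier_mat n n" "Y \<in> carrier_mat m m" "m \<ge> 1" "p < m ^ n"
  shows "blk n (X \<wr> Y) (p + 1) (p + 1) =
    X + mat_sum n (\<lambda>h. Y $$ (digit m n h p, digit m n h p) \<cdot>\<^sub>m C_mat n h) {1..n}"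
proof (rule eq_matI)
  let ?R = "X + mat_sum n (\<lambda>h. Y $$ (digit m n h p, digit m n h p) \<cdot>\<^sub>m C_mat n h) {1..n}"
  fix a c assume "a < dim_row ?R" "c < dim_col ?R"
  then have ac: "a < n" "c < n" by (auto simp: mat_sum_def)
  have "(\<Sum>h\<in>{1..n}. (Y $$ (digit m n h p, digit m n h p) \<cdot>\<^sub>m C_mat n h) $$ (a, c)) =
    (\<Sum>h\<in>{1..n}. if h = Suc a then (if a = c then Y $$ (digit m n h p, digit m n h p) else 0) else 0)"
    using ac by (intro sum.cong) (auto simp: C_mat_def)
  then show "blk n (X \<wr> Y) (p + 1) (p + 1) $$ (a, c) = ?R $$ (a, c)"
    using ac assms index_wreath[OF assms(1-3) assms(4) assms(4) ac]
    by (simp add: blk_def mat_sum_def agree_off_def)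
qed (use assms in \<open>auto simp: blk_def mat_sum_def\<close>)

text \<open>The term from \<open>X\<close> vanishes because \<open>p\<close> and \<open>q\<close>
  differ, and by \<open>agree_off_eq\<close> only the local entry with \<open>Suc a = k\<close> can
  receive an entry of \<open>Y\<close>.\<close>

lemma blk_off_diag:
  fixes X Y :: "'a::comm_ring_1 mat"
  assumes "X \<in> carrier_mat n n" "Y \<in> carrier_mat m m" "m \<ge> 1" "p < m ^ n" "q < m ^ n"
    and "k \<in> {1..n}" "agree_off m n k p q" "p \<noteq> q"
  shows "blk n (X \<wr> Y) (p + 1) (q + 1) = Y $$ (digit m n k p, digit m n k q) \<cdot>\<^sub>m C_mat n k"
proof (rule eq_matI)
  fix a c
  assume "a < dim_row (Y $$ (digit m n k p, digit m n k q) \<cdot>\<^sub>m C_mat n k)"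
    "c < dim_col (Y $$ (digit m n k p, digit m n k q) \<cdot>\<^sub>m C_mat n k)"
  then have ac: "a < n" "c < n" by auto
  have "agree_off m n (Suc a) p q \<longleftrightarrow> Suc a = k"
    using agree_off_eq[of m n "Suc a" p q k] assms(6-8) ac by auto
  then show "blk n (X \<wr> Y) (p + 1) (q + 1) $$ (a, c) =
      (Y $$ (digit m n k p, digit m n k q) \<cdot>\<^sub>m C_mat n k) $$ (a, c)"
    using ac assms(6,8) index_wreath[OF assms(1-5) ac]
    by (auto simp: blk_def C_mat_def)
qed (auto simp: blk_def)

section \<open>Positions of the off-diagonal symbols\<close>

lemma single_one_eq_iff: "Poly_Mapping.single x (1::nat) = Poly_Mapping.single y 1 \<longleftrightarrow> x = y"
  by (metis lookup_single_eq lookup_single_not_eq zero_neq_one)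

text \<open>Coefficients at degree-one monomials tell the symbols apart and, by
  \<open>lookup_sconst\<close>, do not see constants; this is how a block type is
  recognised.\<close>

lemma lookup_svar: "Poly_Mapping.lookup (svar x) (Poly_Mapping.single y 1) = (1 when x = y)"
  unfolding svar_def Poly_Mapping.lookup_single single_one_eq_iff ..

lemma lookup_sconst: "Poly_Mapping.lookup (sconst c) (Poly_Mapping.single y 1) = 0"
  unfolding sconst_def Poly_Mapping.lookup_single
  by (metis lookup_single_eq lookup_zero when_simps(2) zero_neq_one)

lemma index_sym_mat: "a < m \<Longrightarrow> c < m \<Longrightarrow> sym_mat m $$ (a, c) = svar (Entry (a + 1) (c + 1))"
  by (simp add: sym_mat_def)

lemma sym_mat_carrier: "sym_mat m \<in> carrier_mat m m"
  by (simp add: sym_mat_def)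

text \<open>For the forward direction, the coefficient of the symbol in the \<open>k\<close>-th
  diagonal entry of the block is compared: \<open>A\<close> contributes only a constant, so the
  symbol must come from \<open>sym_mat m\<close>, which fixes both digits. The converse is
  \<open>blk_off_diag\<close>, as different \<open>k\<close>-th digits force different
  positions.\<close>

lemma type_positions_iff:
  assumes m: "m \<ge> 1" and A: "A \<in> carrier_mat n n" and ij: "i < m" "j < m" "i \<noteq> j" and k: "k \<in> {1..n}"
  shows "(p + 1, q + 1) \<in> type_positions n m A (i + 1) (j + 1) k \<longleftrightarrow>
    p < m ^ n \<and> q < m ^ n \<and> agree_off m n k p q \<and> digit m n k p = i \<and> digit m n k q = j"
proof -
  have A': "map_mat sconst A \<in> carrier_mat n n" using A by simp
  have "blk n (map_mat sconst A \<wr> sym_mat m) (p + 1) (q + 1) = svar (Entry (i + 1) (j + 1)) \<cdot>\<^sub>m C_mat n k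
    \<longleftrightarrow> agree_off m n k p q \<and> digit m n k p = i \<and> digit m n k q = j"
    if pq: "p < m ^ n" "q < m ^ n"
  proof
    let ?W = "map_mat sconst A \<wr> sym_mat m"
    assume eq: "blk n ?W (p + 1) (q + 1) = svar (Entry (i + 1) (j + 1)) \<cdot>\<^sub>m C_mat n k"
    have k1: "k - 1 < n" "Suc (k - 1) = k" using k by auto
    have "?W $$ (p * n + (k - 1), q * n + (k - 1)) = blk n ?W (p + 1) (q + 1) $$ (k - 1, k - 1)"
      using k1 by (simp add: blk_def)
    also have "\<dots> = svar (Entry (i + 1) (j + 1))"
      unfolding eq using k1 by (simp add: C_mat_def)
    finally have "(if p = q then map_mat sconst A $$ (k - 1, k - 1) else 0) +
        (if agree_off m n k p q then sym_mat m $$ (digit m n k p, digit m n k q) else 0) =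
        svar (Entry (i + 1) (j + 1))"
      using index_wreath[OF A' sym_mat_carrier m pq k1(1) k1(1)] k1(2) by simp
    then have "Poly_Mapping.lookup ((if p = q then map_mat sconst A $$ (k - 1, k - 1) else 0) +
        (if agree_off m n k p q then sym_mat m $$ (digit m n k p, digit m n k q) else 0))
          (Poly_Mapping.single (Entry (i + 1) (j + 1)) 1) = 1"
      by (simp only: lookup_svar when_simps simp_thms)
    then show "agree_off m n k p q \<and> digit m n k p = i \<and> digit m n k q = j"
      using k1 A by (simp add: lookup_add lookup_svar[unfolded One_nat_def]
          lookup_sconst[unfolded One_nat_def] index_sym_mat digit_less[OF m] when_def split: if_splits)
  next
    assume a: "agree_off m n k p q \<and> digit m n k p = i \<and> digit m n k q = j"
    then have "p \<noteq> q" using ij by auto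
    then show "blk n (map_mat sconst A \<wr> sym_mat m) (p + 1) (q + 1) =
        svar (Entry (i + 1) (j + 1)) \<cdot>\<^sub>m C_mat n k"
      using blk_off_diag[OF A' sym_mat_carrier m pq k] a ij by (simp add: index_sym_mat)
  qed
  then show ?thesis
    by (auto simp: type_positions_def Suc_le_eq)
qed

text \<open>A single formula for all \<open>k\<close>, obtained from \<open>agree_off_iff\<close> by
  shifting \<open>s\<close> to start at 1; the requirement that positions lie below
  \<open>m ^ n\<close> becomes the bound on \<open>t\<close>.\<close>

lemma type_positions_eq:
  assumes m: "m \<ge> 1" and A: "A \<in> carrier_mat n n"
    and ij: "i \<in> {1..m}" "j \<in> {1..m}" "i \<noteq> j" and k: "k \<in> {1..n}"
  shows "type_positions n m A i j k =
    (\<lambda>(s, t). ((i - 1) * m ^ (n - k) + s + t * m ^ (n - k + 1),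
               (j - 1) * m ^ (n - k) + s + t * m ^ (n - k + 1)))
      ` ({1..m ^ (n - k)} \<times> {0..m ^ (k - 1) - 1})" (is "_ = ?f ` _")
proof -
  define M where "M = m ^ (n - k)"
  define T where "T = m ^ (k - 1)"
  have e: "m ^ n = T * (M * m)"
  proof -
    have "n = (k - 1) + ((n - k) + 1)" using k by auto
    then show ?thesis unfolding M_def T_def by (metis power_add power_one_right)
  qed
  have pos: "M > 0" "T > 0" using m by (auto simp: M_def T_def)
  \<comment> \<open>The part \<open>i' * M + s\<close> is less than \<open>M * m\<close> and cannot
    carry into \<open>t\<close>, so the bound depends on \<open>t\<close> alone.\<close>
  have below: "i' * M + s + t * (M * m) < m ^ n \<longleftrightarrow> t < T" if "i' < m" "s < M" for i' s t
  proof -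
    have "i' * M + s < m * M" using that by (intro mult_add_less)
    then have "(i' * M + s + t * (M * m)) div (M * m) = t"
      using pos m by (subst div_mult_self1) (auto simp: mult.commute[of M m])
    then show ?thesis
      using div_less_iff_less_mult[of "M * m" "i' * M + s + t * (M * m)" T] pos m by (simp only: e) simp
  qed
  have iff: "(p + 1, q + 1) \<in> type_positions n m A i j k \<longleftrightarrow>
      (\<exists>s t. s < M \<and> t < T \<and> p = (i - 1) * M + s + t * (M * m) \<and> q = (j - 1) * M + s + t * (M * m))"
    for p q
  proof -
    have ij': "i - 1 < m" "j - 1 < m" "i - 1 \<noteq> j - 1" "i - 1 + 1 = i" "j - 1 + 1 = j" using ij by auto
    have "(p + 1, q + 1) \<in> type_positions n m A i j k \<longleftrightarrow> p < m ^ n \<and> q < m ^ n \<and>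
      (\<exists>s t. s < M \<and> p = (i - 1) * M + s + t * (M * m) \<and> q = (j - 1) * M + s + t * (M * m))"
      using type_positions_iff[OF m A ij'(1-3) k, of p q] agree_off_iff[OF ij'(1,2) m, of n k p q]
      unfolding ij'(4,5) by (simp add: M_def mult.commute)
    then show ?thesis using below ij' by blast
  qed
  have "x \<in> type_positions n m A i j k \<longleftrightarrow> x \<in> ?f ` ({1..M} \<times> {0..T - 1})" for x
  proof
    assume x: "x \<in> type_positions n m A i j k"
    \<comment> \<open>Block positions start at 1, so both components are successors.\<close>
    then obtain p q where pq: "x = (p + 1, q + 1)"
      unfolding type_positions_def by (cases x; cases "fst x"; cases "snd x") auto
    then obtain s t where "s < M" "t < T" "p = (i - 1) * M + s + t * (M * m)"
      "q = (j - 1) * M + s + t * (M * m)"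
      using x iff by blast
    then show "x \<in> ?f ` ({1..M} \<times> {0..T - 1})"
      unfolding pq by (intro image_eqI[of _ _ "(s + 1, t)"]) (auto simp: M_def)
  next
    assume "x \<in> ?f ` ({1..M} \<times> {0..T - 1})"
    then obtain s t where st: "s \<in> {1..M}" "t \<in> {0..T - 1}" "x = ?f (s, t)" by blast
    define p where "p = (i - 1) * M + (s - 1) + t * (M * m)"
    define q where "q = (j - 1) * M + (s - 1) + t * (M * m)"
    have "x = (p + 1, q + 1)" using st by (auto simp: p_def q_def M_def)
    moreover have "s - 1 < M" "t < T" using st pos by auto
    ultimately show "x \<in> type_positions n m A i j k" using iff p_def q_def by blast
  qed
  then show ?thesis unfolding M_def T_def by blast
qed

text \<open>The parametrisation by \<open>(s, t)\<close> is injective already in its first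
  component, so the count is \<open>m ^ (n - k) * m ^ (k - 1)\<close>.\<close>

lemma card_type_positions:
  assumes m: "m \<ge> 1" and "A \<in> carrier_mat n n"
    and ij: "i \<in> {1..m}" "j \<in> {1..m}" "i \<noteq> j" and k: "k \<in> {1..n}"
  shows "card (type_positions n m A i j k) = m ^ (n - 1)"
proof -
  define M where "M = m ^ (n - k)"
  have M: "M > 0" using m by (simp add: M_def)
  have inj: "s = s' \<and> t = t'"
    if eq: "s + t * (M * m) = s' + t' * (M * m)"
      and s: "Suc 0 \<le> s" "s \<le> M" "Suc 0 \<le> s'" "s' \<le> M" for s s' t t'
  proof -
    \<comment> \<open>With \<open>s\<close> shifted down it is a genuine remainder modulo
      \<open>M\<close>; the value \<open>s = M\<close> itself would not be one.\<close>
    have "(s - 1) + (t * m) * M = (s' - 1) + (t' * m) * M"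
      using eq s by (auto simp: algebra_simps)
    moreover have "(v + u * M) mod M = v" "(v + u * M) div M = u" if "v < M" for u v
      using that by auto
    moreover have "s - 1 < M" "s' - 1 < M" using s M by auto
    ultimately have "s - 1 = s' - 1" "t * m = t' * m" by metis+
    then show ?thesis using s m by auto
  qed
  have "card (type_positions n m A i j k) = card ({1..M} \<times> {0..m ^ (k - 1) - 1})"
    unfolding type_positions_eq[OF assms] M_def[symmetric]
    by (rule card_image) (auto simp: inj_on_def M_def[symmetric] mult.commute[of m] dest: inj)
  also have "\<dots> = m ^ (n - k) * m ^ (k - 1)"
    using m by (simp add: M_def card_cartesian_product)
  also have "\<dots> = m ^ (n - 1)" using k by (simp flip: power_add)
  finally show ?thesis .
qed

section \<open>The lexicographic order\<close>

lemma diag_tuple_nth: "h \<in> {1..n} \<Longrightarrow> diag_tuple m n p ! (h - 1) = Entry (digit m n h p + 1) (digit m n h p + 1)"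
  unfolding diag_tuple_def by (subst nth_map_upt) auto

lemma diag_tuple_in_Omega:
  assumes "m \<ge> 1"
  shows "diag_tuple m n p \<in> Omega n m"
  using digit_less[OF assms, of n _ p]
  by (auto simp: Omega_def diag_tuple_def diag_symbols_def Suc_le_eq simp del: upt_Suc)

text \<open>At the first differing digit the quotients by \<open>M\<close> are ordered like
  \<open>p\<close> and \<open>q\<close>, while the digits before it agree; so the smaller number has
  the smaller digit there.\<close>

lemma diag_tuple_less:
  assumes m: "m \<ge> 1" and "p < q" "q < m ^ n"
  shows "(diag_tuple m n p, diag_tuple m n q) \<in> Omega_less n m"
proof -
  define P where "P h \<longleftrightarrow> h < n \<and> diag_tuple m n p ! h \<noteq> diag_tuple m n q ! h" for h
  have P_iff: "P h \<longleftrightarrow> h < n \<and> digit m n (Suc h) p \<noteq> digit m n (Suc h) q" for h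
    using diag_tuple_nth[of "Suc h" n m] by (auto simp: P_def)
  have "\<exists>h. P h"
  proof (rule ccontr)
    assume none: "\<nexists>h. P h"
    have "digit m n h p = digit m n h q" if "h \<in> {1..n}" for h
      using none P_iff[of "h - 1"] that by auto
    then show False using digits_inject[of p m n q] assms by auto
  qed
  \<comment> \<open>List index \<open>l\<close> counts from 0, so the digit in question is number
    \<open>Suc l\<close>.\<close>
  define l where "l = (LEAST h. P h)"
  have l: "P l" unfolding l_def using \<open>\<exists>h. P h\<close> by (rule LeastI_ex)
  have before: "digit m n h p = digit m n h q" if "h \<in> {1..l}" for h
  proof -
    have "\<not> P (h - 1)" using that by (auto simp: l_def intro!: not_less_Least)
    then show ?thesis using that l by (auto simp: P_iff)
  qed
  have ln: "l < n" using l P_iff by auto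
  define M where "M = m ^ (n - Suc l)"
  have e: "m ^ (n - l) = M * m"
    unfolding M_def using ln by (metis Suc_diff_Suc power_Suc2)
  have "p div M div m = q div M div m"
    using div_eq_if_digits_eq[of l n p m q] before ln assms by (simp add: e div_mult2_eq)
  moreover have "p div M \<le> q div M" using assms by (simp add: div_le_mono)
  moreover have "p div M mod m \<noteq> q div M mod m" using l by (simp add: P_iff digit_def M_def)
  ultimately have "p div M mod m < q div M mod m"
    by (metis add_le_cancel_left le_neq_implies_less mult_div_mod_eq)
  then have "digit m n (Suc l) p < digit m n (Suc l) q" by (simp add: digit_def M_def)
  then have "(diag_tuple m n p ! l, diag_tuple m n q ! l) \<in> diag_less m"
    using diag_tuple_nth[of "Suc l" n m] ln digit_less[OF m, of n "Suc l"]
    by (auto simp: diag_less_def Suc_le_eq)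
  moreover have "diag_tuple m n p \<noteq> diag_tuple m n q" using l by (auto simp: P_def)
  ultimately show ?thesis
    using diag_tuple_in_Omega[OF m] by (simp add: Omega_less_def Let_def l_def P_def)
qed

text \<open>Injectivity follows from strict monotonicity, since \<open>Omega_less\<close> relates
  only distinct tuples; surjectivity comes from summing the prescribed digits by
  \<open>digits_of_sum\<close>.\<close>

lemma bij_diag_tuple:
  assumes m: "m \<ge> 1"
  shows "bij_betw (diag_tuple m n) {..<m ^ n} (Omega n m)"
proof (rule bij_betwI')
  fix p q assume "p \<in> {..<m ^ n}" "q \<in> {..<m ^ n}"
  then show "diag_tuple m n p = diag_tuple m n q \<longleftrightarrow> p = q"
    using diag_tuple_less[OF m, of p q n] diag_tuple_less[OF m, of q p n]
    by (cases p q rule: linorder_cases) (auto simp: Omega_less_def)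
next
  fix bs assume bs: "bs \<in> Omega n m"
  have "\<exists>d<m. bs ! (h - 1) = Entry (d + 1) (d + 1)" if "h \<in> {1..n}" for h
  proof -
    have "bs ! (h - 1) \<in> diag_symbols m" using bs that by (auto simp: Omega_def)
    then obtain i where "i \<in> {1..m}" "bs ! (h - 1) = Entry i i" by (auto simp: diag_symbols_def)
    then show ?thesis by (intro exI[of _ "i - 1"]) auto
  qed
  then obtain f where f: "\<And>h. h \<in> {1..n} \<Longrightarrow> f h < m \<and> bs ! (h - 1) = Entry (f h + 1) (f h + 1)"
    by metis
  define p where "p = (\<Sum>h=1..n. f h * m ^ (n - h))"
  have p: "p < m ^ n" "\<And>h. h \<in> {1..n} \<Longrightarrow> digit m n h p = f h"
    using digits_of_sum[of n f m] f unfolding p_def by blast+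
  have "bs = diag_tuple m n p"
  proof (rule nth_equalityI)
    show "length bs = length (diag_tuple m n p)" using bs by (simp add: Omega_def diag_tuple_def)
    fix h assume "h < length bs"
    then have "Suc h \<in> {1..n}" using bs by (simp add: Omega_def)
    then show "bs ! h = diag_tuple m n p ! h"
      using f[of "Suc h"] p(2)[of "Suc h"] diag_tuple_nth[of "Suc h" n m p] by simp
  qed
  then show "\<exists>p\<in>{..<m ^ n}. bs = diag_tuple m n p" using p(1) by auto
qed (rule diag_tuple_in_Omega[OF m])

text \<open>The tuples of the positions \<open>0, ..., m ^ n - 1\<close>, in this order, form the
  increasing enumeration of \<open>Omega n m\<close>.\<close>

lemma is_pth_diag_tuple:
  assumes m: "m \<ge> 1" and p: "p < m ^ n"
  shows "is_pth (Omega_less n m) (Omega n m) (p + 1) (diag_tuple m n p)"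
  unfolding is_pth_def
proof (intro exI conjI)
  let ?xs = "map (diag_tuple m n) [0..<m ^ n]"
  show "sorted_wrt (\<lambda>y z. (y, z) \<in> Omega_less n m) ?xs"
    using diag_tuple_less[OF m] by (auto simp: sorted_wrt_iff_nth_less)
  show "distinct ?xs" "set ?xs = Omega n m"
    using bij_diag_tuple[OF m, of n] by (auto simp: distinct_map bij_betw_def atLeast0LessThan)
  show "p + 1 \<in> {1..length ?xs}" "?xs ! (p + 1 - 1) = diag_tuple m n p" using p by auto
qed

section \<open>Positions of symbols, diagonal blocks and the bijection for complex matrices\<close>

theorem lemma2p4:
  fixes n m :: nat and A B :: "complex mat"
  assumes "n \<ge> 1" and "m \<ge> 1"
    and "A \<in> carrier_mat n n" and "B \<in> carrier_mat m m"
  shows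
    "(\<forall>i\<in>{1..m}. \<forall>j\<in>{1..m}. \<forall>k\<in>{1..n}. i \<noteq> j \<longrightarrow>
        card (type_positions n m A i j k) = m ^ (n - 1) \<and>
        (\<forall>(p, q)\<in>type_positions n m A i j k.
           blk n (A \<wr> B) p q = entry_val B (Entry i j) \<cdot>\<^sub>m C_mat n k) \<and>
        (k \<in> {2..n - 1} \<longrightarrow> type_positions n m A i j k =
           {((i - 1) * m ^ (n - k) + s + t * m ^ (n - k + 1),
             (j - 1) * m ^ (n - k) + s + t * m ^ (n - k + 1)) | s t.
              s \<in> {1..m ^ (n - k)} \<and> t \<in> {0..m ^ (k - 1) - 1}}) \<and>
        (k = 1 \<longrightarrow> type_positions n m A i j k =
           {((i - 1) * m ^ (n - 1) + s, (j - 1) * m ^ (n - 1) + s) | s. s \<in> {1..m ^ (n - 1)}}) \<and>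
        (k = n \<longrightarrow> type_positions n m A i j k =
           {(i + t * m, j + t * m) | t. t \<in> {0..m ^ (n - 1) - 1}}))
     \<and>
     (\<forall>p\<in>{1..m ^ n}.
        (\<exists>f\<in>{1..n} \<rightarrow> {0..m - 1}. p = 1 + (\<Sum>h=1..n. f h * m ^ (n - h))) \<and>
        (\<forall>f\<in>{1..n} \<rightarrow> {0..m - 1}. p = 1 + (\<Sum>h=1..n. f h * m ^ (n - h)) \<longrightarrow>
           blk n (A \<wr> B) p p =
             A + mat_sum n (\<lambda>h. entry_val B (Entry (f h + 1) (f h + 1)) \<cdot>\<^sub>m C_mat n h) {1..n} \<and>
           is_pth (Omega_less n m) (Omega n m) p
             (map (\<lambda>h. Entry (f h + 1) (f h + 1)) [1..<n + 1])))
     \<and>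
     (\<exists>\<phi>. bij_betw \<phi> (Omega n m) {1..m ^ n} \<and>
        (\<forall>bs\<in>Omega n m.
           is_pth (Omega_less n m) (Omega n m) (\<phi> bs) bs \<and>
           blk n (map_mat sconst A \<wr> sym_mat m) (\<phi> bs) (\<phi> bs) =
             map_mat sconst A + mat_sum n (\<lambda>h. svar (bs ! (h - 1)) \<cdot>\<^sub>m C_mat n h) {1..n} \<and>
           blk n (A \<wr> B) (\<phi> bs) (\<phi> bs) =
             A + mat_sum n (\<lambda>h. entry_val B (bs ! (h - 1)) \<cdot>\<^sub>m C_mat n h) {1..n}))"
proof (intro conjI)
  note m = assms(2) and A = assms(3) and B = assms(4)
  have A': "map_mat sconst A \<in> carrier_mat n n" using A by simp
  show "\<forall>i\<in>{1..m}. \<forall>j\<in>{1..m}. \<forall>k\<in>{1..n}. i \<noteq> j \<longrightarrow>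
        card (type_positions n m A i j k) = m ^ (n - 1) \<and>
        (\<forall>(p, q)\<in>type_positions n m A i j k.
           blk n (A \<wr> B) p q = entry_val B (Entry i j) \<cdot>\<^sub>m C_mat n k) \<and>
        (k \<in> {2..n - 1} \<longrightarrow> type_positions n m A i j k =
           {((i - 1) * m ^ (n - k) + s + t * m ^ (n - k + 1),
             (j - 1) * m ^ (n - k) + s + t * m ^ (n - k + 1)) | s t.
              s \<in> {1..m ^ (n - k)} \<and> t \<in> {0..m ^ (k - 1) - 1}}) \<and>
        (k = 1 \<longrightarrow> type_positions n m A i j k =
           {((i - 1) * m ^ (n - 1) + s, (j - 1) * m ^ (n - 1) + s) | s. s \<in> {1..m ^ (n - 1)}}) \<and>
        (k = n \<longrightarrow> type_positions n m A i j k =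
           {(i + t * m, j + t * m) | t. t \<in> {0..m ^ (n - 1) - 1}})"
  proof (intro ballI impI conjI)
    fix i j k assume ij: "i \<in> {1..m}" "j \<in> {1..m}" and k: "k \<in> {1..n}" and ne: "i \<noteq> j"
    note tp = type_positions_eq[OF m A ij ne k]
    show "card (type_positions n m A i j k) = m ^ (n - 1)"
      by (rule card_type_positions[OF m A ij ne k])
    \<comment> \<open>The digits that locate the symbol in the formal product select the
      corresponding entry of the complex matrix \<open>B\<close>.\<close>
    show "case x of (p, q) \<Rightarrow> blk n (A \<wr> B) p q = entry_val B (Entry i j) \<cdot>\<^sub>m C_mat n k"
      if x: "x \<in> type_positions n m A i j k" for x
    proof -
      from x obtain p q where pq: "x = (p + 1, q + 1)"
        unfolding type_positions_def by (cases x; cases "fst x"; cases "snd x") auto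
      have ij': "i - 1 < m" "j - 1 < m" "i - 1 \<noteq> j - 1" "i - 1 + 1 = i" "j - 1 + 1 = j"
        using ij ne by auto
      have "p < m ^ n" "q < m ^ n" "agree_off m n k p q" "digit m n k p = i - 1" "digit m n k q = j - 1"
        using x type_positions_iff[OF m A ij'(1-3) k, of p q] unfolding pq ij'(4,5) by auto
      moreover from this have "p \<noteq> q" using ij' by auto
      ultimately show ?thesis
        using blk_off_diag[OF A B m _ _ k, of p q] by (simp add: pq)
    qed
    show "type_positions n m A i j k =
           {((i - 1) * m ^ (n - k) + s + t * m ^ (n - k + 1),
             (j - 1) * m ^ (n - k) + s + t * m ^ (n - k + 1)) | s t.
              s \<in> {1..m ^ (n - k)} \<and> t \<in> {0..m ^ (k - 1) - 1}}"
      unfolding tp by fast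
    \<comment> \<open>For \<open>k = 1\<close> the bound \<open>m ^ 0 - 1\<close> leaves only
      \<open>t = 0\<close>.\<close>
    show "type_positions n m A i j k =
           {((i - 1) * m ^ (n - 1) + s, (j - 1) * m ^ (n - 1) + s) | s. s \<in> {1..m ^ (n - 1)}}"
      if "k = 1"
      unfolding that tp[unfolded that] by (auto simp: image_iff)
    \<comment> \<open>For \<open>k = n\<close> only \<open>s = 1\<close> remains, and it turns
      \<open>i - 1\<close> and \<open>j - 1\<close> into \<open>i\<close> and
      \<open>j\<close>.\<close>
    show "type_positions n m A i j k = {(i + t * m, j + t * m) | t. t \<in> {0..m ^ (n - 1) - 1}}"
      if "k = n"
      unfolding that tp[unfolded that] using ij by (auto simp: image_iff)
  qed
  show "\<forall>p\<in>{1..m ^ n}.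
        (\<exists>f\<in>{1..n} \<rightarrow> {0..m - 1}. p = 1 + (\<Sum>h=1..n. f h * m ^ (n - h))) \<and>
        (\<forall>f\<in>{1..n} \<rightarrow> {0..m - 1}. p = 1 + (\<Sum>h=1..n. f h * m ^ (n - h)) \<longrightarrow>
           blk n (A \<wr> B) p p =
             A + mat_sum n (\<lambda>h. entry_val B (Entry (f h + 1) (f h + 1)) \<cdot>\<^sub>m C_mat n h) {1..n} \<and>
           is_pth (Omega_less n m) (Omega n m) p
             (map (\<lambda>h. Entry (f h + 1) (f h + 1)) [1..<n + 1]))"
  proof (intro ballI conjI impI)
    fix p assume p: "p \<in> {1..m ^ n}"
    have p': "p - 1 < m ^ n" "p = (p - 1) + 1" using p by auto
    show "\<exists>f\<in>{1..n} \<rightarrow> {0..m - 1}. p = 1 + (\<Sum>h=1..n. f h * m ^ (n - h))"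
    proof (rule bexI[of _ "\<lambda>h. digit m n h (p - 1)"])
      show "p = 1 + (\<Sum>h=1..n. digit m n h (p - 1) * m ^ (n - h))"
        unfolding sum_of_digits[OF m p'(1)] using p'(2) by simp
      have "digit m n h (p - 1) \<le> m - 1" for h using digit_less[OF m, of n h "p - 1"] by linarith
      then show "(\<lambda>h. digit m n h (p - 1)) \<in> {1..n} \<rightarrow> {0..m - 1}"
        by auto
    qed
    fix f assume f: "f \<in> {1..n} \<rightarrow> {0..m - 1}" and pf: "p = 1 + (\<Sum>h=1..n. f h * m ^ (n - h))"
    have "f h < m" if "h \<in> {1..n}" for h
      using funcset_mem[OF f that] m by (simp add: le_imp_less_Suc Suc_le_eq)
    \<comment> \<open>Any admissible \<open>f\<close> consists of the digits of
      \<open>p - 1\<close>, so the results on \<open>diag_tuple\<close> apply to it.\<close>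
    then have d: "digit m n h (p - 1) = f h" if "h \<in> {1..n}" for h
      using digits_of_sum[of n f m] that unfolding pf by simp
    have "mat_sum n (\<lambda>h. B $$ (digit m n h (p - 1), digit m n h (p - 1)) \<cdot>\<^sub>m C_mat n h) {1..n} =
        mat_sum n (\<lambda>h. entry_val B (Entry (f h + 1) (f h + 1)) \<cdot>\<^sub>m C_mat n h) {1..n}"
      by (simp add: mat_sum_def d cong: sum.cong_simp del: One_nat_def)
    then show "blk n (A \<wr> B) p p =
        A + mat_sum n (\<lambda>h. entry_val B (Entry (f h + 1) (f h + 1)) \<cdot>\<^sub>m C_mat n h) {1..n}"
      using blk_diag[OF A B m p'(1)] p'(2) by simp
    have "map (\<lambda>h. Entry (f h + 1) (f h + 1)) [1..<n + 1] = diag_tuple m n (p - 1)"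
      using d by (auto simp: diag_tuple_def simp del: upt_Suc)
    then show "is_pth (Omega_less n m) (Omega n m) p (map (\<lambda>h. Entry (f h + 1) (f h + 1)) [1..<n + 1])"
      using is_pth_diag_tuple[OF m p'(1)] p'(2) by simp
  qed
  \<comment> \<open>The rank of a tuple: the zero-based position that \<open>diag_tuple\<close>
    sends to it, raised by 1.\<close>
  define \<phi> where "\<phi> = Suc \<circ> the_inv_into {..<m ^ n} (diag_tuple m n)"
  have bij: "bij_betw \<phi> (Omega n m) {1..m ^ n}"
    unfolding \<phi>_def
  proof (rule bij_betw_trans)
    show "bij_betw (the_inv_into {..<m ^ n} (diag_tuple m n)) (Omega n m) {..<m ^ n}"
      by (rule bij_betw_the_inv_into[OF bij_diag_tuple[OF m]])
    show "bij_betw Suc {..<m ^ n} {1..m ^ n}"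
      by (simp add: bij_betw_def image_Suc_lessThan)
  qed
  show "\<exists>\<phi>. bij_betw \<phi> (Omega n m) {1..m ^ n} \<and>
        (\<forall>bs\<in>Omega n m.
           is_pth (Omega_less n m) (Omega n m) (\<phi> bs) bs \<and>
           blk n (map_mat sconst A \<wr> sym_mat m) (\<phi> bs) (\<phi> bs) =
             map_mat sconst A + mat_sum n (\<lambda>h. svar (bs ! (h - 1)) \<cdot>\<^sub>m C_mat n h) {1..n} \<and>
           blk n (A \<wr> B) (\<phi> bs) (\<phi> bs) =
             A + mat_sum n (\<lambda>h. entry_val B (bs ! (h - 1)) \<cdot>\<^sub>m C_mat n h) {1..n})"
  proof (rule exI[of _ \<phi>], intro conjI bij ballI)
    fix bs assume "bs \<in> Omega n m"
    then obtain p where p: "p < m ^ n" and bs: "bs = diag_tuple m n p"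
      using bij_diag_tuple[OF m, of n] by (auto simp: bij_betw_def)
    have \<phi>: "\<phi> bs = p + 1"
      using bij_diag_tuple[OF m, of n] p by (simp add: \<phi>_def bs bij_betw_def the_inv_into_f_f)
    show "is_pth (Omega_less n m) (Omega n m) (\<phi> bs) bs"
      unfolding \<phi> unfolding bs by (rule is_pth_diag_tuple[OF m p])
    have "mat_sum n (\<lambda>h. sym_mat m $$ (digit m n h p, digit m n h p) \<cdot>\<^sub>m C_mat n h) {1..n} =
        mat_sum n (\<lambda>h. svar (bs ! (h - 1)) \<cdot>\<^sub>m C_mat n h) {1..n}"
      unfolding bs mat_sum_def
      by (simp add: diag_tuple_nth index_sym_mat digit_less[OF m] cong: sum.cong_simp del: One_nat_def)
    then show "blk n (map_mat sconst A \<wr> sym_mat m) (\<phi> bs) (\<phi> bs) =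
        map_mat sconst A + mat_sum n (\<lambda>h. svar (bs ! (h - 1)) \<cdot>\<^sub>m C_mat n h) {1..n}"
      unfolding \<phi> using blk_diag[OF A' sym_mat_carrier m p] by simp
    have "mat_sum n (\<lambda>h. B $$ (digit m n h p, digit m n h p) \<cdot>\<^sub>m C_mat n h) {1..n} =
        mat_sum n (\<lambda>h. entry_val B (bs ! (h - 1)) \<cdot>\<^sub>m C_mat n h) {1..n}"
      unfolding bs mat_sum_def
      by (simp add: diag_tuple_nth cong: sum.cong_simp del: One_nat_def)
    then show "blk n (A \<wr> B) (\<phi> bs) (\<phi> bs) =
        A + mat_sum n (\<lambda>h. entry_val B (bs ! (h - 1)) \<cdot>\<^sub>m C_mat n h) {1..n}"
      unfolding \<phi> using blk_diag[OF A B m p] by simp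
  qed
qed

end
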